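(* Let $n_1,n_2\geq1$. The null periodic X-ray transform is injective on a conformal Minkowski torus of signature $(n_1,n_2)$ if and only if $n_1\geq2$ and $n_2\geq2$. If it is injective, it is injective on distributions. If it is not injective, it is non-injective on the space of trigonometric polynomials.
   Context: The Minkowski space $\mathbb{R}^{n_1,n_2}$ is $\mathbb{R}^{n_1+n_2}$ with the pseudo-Riemannian metric $\mathrm{d}x_1^2+\cdots+\mathrm{d}x_{n_1}^2-\mathrm{d}x_{n_1+1}^2-\cdots-\mathrm{d}x_{n_1+n_2}^2$. The Minkowski torus of signature $(n_1,n_2)$ is the quotient $\mathbb{T}^{n_1,n_2}=\mathbb{R}^{n_1,n_2}/\mathbb{Z}^{n_1+n_2}$ with the induced metric $g$, and a conformal Minkowski torus is the same torus with the metric $cg$, where $c$ is a smooth positive function. A null geodesic is a geodesic whose tangent vectors have zero square in the metric. The null periodic X-ray transform on a conformal Minkowski torus takes a function on the torus to its integrals over all periodic (closed) null geodesics of the metric $cg$; only closed null geodesics are included. The transform is injective on a space of functions or distributions if an element of the space can be recovered from the knowledge of these integrals. As unparametrized curves the null geodesics of $cg$ and $g$ coincide; the conformal change only reparametrizes them, and knowing the integrals of $f$ over null geodesics of $cg$ is taken to be equivalent to knowing the integrals of $\sqrt{c}f$ with respect to $g$. For the standard metric $g$ the integrals of $f$ are $R_vf(x)=\int_0^1f(x+tv)\,\mathrm{d}t$ for all non-zero null $v\in\mathbb{Z}^{n_1+n_2}$, that is, $v_1^2+\cdots+v_{n_1}^2=v_{n_1+1}^2+\cdots+v_{n_1+n_2}^2$;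 for a distribution $f$, $R_vf$ is defined by duality, $\langle R_vf,\phi\rangle=\langle f,R_v\phi\rangle$ for $\phi\in C^\infty(\mathbb{T}^{n_1,n_2})$. Trigonometric polynomials are finite linear combinations of the functions $x\mapsto e^{2\pi ik\cdot x}$, $k\in\mathbb{Z}^{n_1+n_2}$.
   Formalization: For a conformal factor c, "trigonometric polynomials" in the last sentence means functions f for which √c·f is a trigonometric polynomial (the usual space when c = 1); with the unweighted space that sentence fails for some c. *)

theory Defs
  imports "HOL-Analysis.Analysis"
begin

text \<open>
  Vectors in Minkowski space of signature \<open>(n1, n2)\<close> are indexed by the sum type \<open>'a + 'b\<close>
  with \<open>n1 = CARD('a)\<close> and \<open>n2 = CARD('b)\<close>, which are at least 1 because types are nonempty.
  Functions on the torus are represented by their periodic lifts.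
\<close>

definition minkowski :: "real ^ ('a::finite + 'b::finite) \<Rightarrow> real ^ ('a + 'b) \<Rightarrow> real" where
  "minkowski v w = (\<Sum>i\<in>UNIV. v $ Inl i * w $ Inl i) - (\<Sum>j\<in>UNIV. v $ Inr j * w $ Inr j)"

definition integer_vectors :: "(real ^ 'n) set" where
  "integer_vectors = {v. \<forall>i. v $ i \<in> \<int>}"

definition null_vectors :: "(real ^ ('a::finite + 'b::finite)) set" where
  "null_vectors = {v \<in> integer_vectors. v \<noteq> 0 \<and> minkowski v v = 0}"

definition periodic :: "(real ^ 'n \<Rightarrow> 'c) \<Rightarrow> bool" where
  "periodic f \<longleftrightarrow> (\<forall>m\<in>integer_vectors. \<forall>x. f (x + m) = f x)"

definition partial :: "'n \<Rightarrow> (real ^ 'n \<Rightarrow> 'c::real_normed_vector) \<Rightarrow> real ^ 'n \<Rightarrow> 'c" where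
  "partial i f = (\<lambda>x. frechet_derivative f (at x) (axis i 1))"

definition partials :: "'n list \<Rightarrow> (real ^ 'n \<Rightarrow> 'c::real_normed_vector) \<Rightarrow> real ^ 'n \<Rightarrow> 'c" where
  "partials is f = fold partial is f"

definition smooth :: "(real ^ 'n \<Rightarrow> 'c::real_normed_vector) \<Rightarrow> bool" where
  "smooth f \<longleftrightarrow> (\<forall>is x. partials is f differentiable (at x))"

definition conformal_factor :: "(real ^ 'n \<Rightarrow> real) \<Rightarrow> bool" where
  "conformal_factor c \<longleftrightarrow> smooth c \<and> periodic c \<and> (\<forall>x. c x > 0)"

definition continuous_functions :: "(real ^ 'n \<Rightarrow> complex) set" where
  "continuous_functions = {f. periodic f \<and> continuous_on UNIV f}"

definition test_functions :: "(real ^ 'n \<Rightarrow> complex) set" where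
  "test_functions = {\<phi>. periodic \<phi> \<and> smooth \<phi>}"

definition trig_polys :: "(real ^ 'n \<Rightarrow> complex) set" where
  "trig_polys =
     {f. \<exists>K a. finite K \<and> K \<subseteq> integer_vectors \<and>
           f = (\<lambda>x. \<Sum>k\<in>K. a k * exp (2 * of_real pi * \<i> * of_real (k \<bullet> x)))}"

text \<open>
  The conformal change acts on functions through \<open>f \<mapsto> sqrt c * f\<close>.  The space of trigonometric
  polynomials is read through this identification.  Without the weight, non-injectivity would fail:
  in signature (1,1) there are conformal factors \<open>c\<close> for which no non-zero trigonometric
  polynomial \<open>f\<close> has vanishing integrals of \<open>sqrt c * f\<close> over all closed null geodesics.
\<close>

definition conformal_weight :: "(real ^ 'n \<Rightarrow> real) \<Rightarrow> (real ^ 'n \<Rightarrow> complex) \<Rightarrow> real ^ 'n \<Rightarrow> complex" where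
  "conformal_weight c f = (\<lambda>x. of_real (sqrt (c x)) * f x)"

definition conformal_trig_polys :: "(real ^ 'n \<Rightarrow> real) \<Rightarrow> (real ^ 'n \<Rightarrow> complex) set" where
  "conformal_trig_polys c = {f. conformal_weight c f \<in> trig_polys}"

lemma conformal_trig_polys_standard: "conformal_trig_polys (\<lambda>_. 1) = trig_polys"
  by (simp add: conformal_trig_polys_def conformal_weight_def)

definition line_integral :: "real ^ 'n \<Rightarrow> (real ^ 'n \<Rightarrow> complex) \<Rightarrow> real ^ 'n \<Rightarrow> complex" where
  "line_integral v f = (\<lambda>x. integral {0..1} (\<lambda>t. f (x + t *\<^sub>R v)))"

definition null_xray ::
    "(real ^ ('a::finite + 'b::finite) \<Rightarrow> real) \<Rightarrow> (real ^ ('a + 'b) \<Rightarrow> complex) \<Rightarrow>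
      real ^ ('a + 'b) \<Rightarrow> real ^ ('a + 'b) \<Rightarrow> complex" where
  "null_xray c f = (\<lambda>v\<in>null_vectors. line_integral v (conformal_weight c f))"

text \<open>
  Convergence in the Frechet space of test functions is uniform convergence of all derivatives, so
  continuity is sequential continuity.  Functionals are extensional (undefined away from test
  functions), so that equality of distributions is equality in HOL.
\<close>

definition test_convergent ::
    "(nat \<Rightarrow> real ^ 'n \<Rightarrow> complex) \<Rightarrow> (real ^ 'n \<Rightarrow> complex) \<Rightarrow> bool" where
  "test_convergent \<Phi> \<phi> \<longleftrightarrow>
     (\<forall>is. uniform_limit UNIV (\<lambda>n. partials is (\<Phi> n)) (partials is \<phi>) sequentially)"

definition distributions :: "((real ^ 'n \<Rightarrow> complex) \<Rightarrow> complex) set" where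
  "distributions =
     {T \<in> extensional test_functions.
        (\<forall>\<phi>\<in>test_functions. \<forall>\<psi>\<in>test_functions. T (\<lambda>x. \<phi> x + \<psi> x) = T \<phi> + T \<psi>) \<and>
        (\<forall>a. \<forall>\<phi>\<in>test_functions. T (\<lambda>x. a * \<phi> x) = a * T \<phi>) \<and>
        (\<forall>\<Phi>. \<forall>\<phi>\<in>test_functions. (\<forall>n. \<Phi> n \<in> test_functions) \<longrightarrow> test_convergent \<Phi> \<phi> \<longrightarrow>
           (\<lambda>n. T (\<Phi> n)) \<longlonglongrightarrow> T \<phi>)}"

text \<open>
  Both operations are defined by duality with respect to the bilinear pairing, in which
  multiplication by \<open>sqrt c\<close> and \<open>line_integral v\<close> are symmetric.
\<close>

definition conformal_weight_distr ::
    "(real ^ 'n \<Rightarrow> real) \<Rightarrow> ((real ^ 'n \<Rightarrow> complex) \<Rightarrow> complex) \<Rightarrow> (real ^ 'n \<Rightarrow> complex) \<Rightarrow> complex" where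
  "conformal_weight_distr c T = (\<lambda>\<phi>\<in>test_functions. T (conformal_weight c \<phi>))"

definition line_integral_distr ::
    "real ^ 'n \<Rightarrow> ((real ^ 'n \<Rightarrow> complex) \<Rightarrow> complex) \<Rightarrow> (real ^ 'n \<Rightarrow> complex) \<Rightarrow> complex" where
  "line_integral_distr v T = (\<lambda>\<phi>\<in>test_functions. T (line_integral v \<phi>))"

definition null_xray_distr ::
    "(real ^ ('a::finite + 'b::finite) \<Rightarrow> real) \<Rightarrow> ((real ^ ('a + 'b) \<Rightarrow> complex) \<Rightarrow> complex) \<Rightarrow>
      real ^ ('a + 'b) \<Rightarrow> (real ^ ('a + 'b) \<Rightarrow> complex) \<Rightarrow> complex" where
  "null_xray_distr c T = (\<lambda>v\<in>null_vectors. line_integral_distr v (conformal_weight_distr c T))"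

end

theory Submission
  imports Defs
begin

text \<open>
  If \<open>k \<bullet> v = 0\<close>, integration along \<open>v\<close> does not change the \<open>k\<close>-th Fourier mode, so injectivity
  amounts to finding, for every integer vector \<open>k\<close>, a null vector orthogonal to it.  When both
  \<open>n1\<close> and \<open>n2\<close> are at least 2 the pseudo-metric admits integral totally null planes, and every
  such plane contains a vector orthogonal to \<open>k\<close>.  When \<open>n1 = 1\<close> or \<open>n2 = 1\<close>, the unit vector \<open>k\<close>
  in the one-dimensional factor has \<open>k \<bullet> v \<noteq> 0\<close> for all null \<open>v\<close>, and its character is invisible.
  Fourier modes determine functions and distributions because Fejer means, taken in one variable
  at a time, converge uniformly together with all derivatives.
\<close>

subsection \<open>Smooth functions\<close>

lemma partials_Nil [simp]: "partials [] f = f"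
  and partials_Cons [simp]: "partials (i # is) f = partials is (partial i f)"
  by (simp_all add: partials_def)

lemma smooth_differentiable: "smooth f \<Longrightarrow> f differentiable (at x)"
  unfolding smooth_def by (metis partials_Nil)

lemma smooth_partial: "smooth f \<Longrightarrow> smooth (partial i f)"
  unfolding smooth_def by (metis partials_Cons)

lemma smooth_continuous_on: "smooth f \<Longrightarrow> continuous_on A f"
  using differentiable_imp_continuous_within[OF smooth_differentiable]
  by (auto intro: continuous_at_imp_continuous_on)

text \<open>Smoothness is the largest property that implies differentiability and is stable under
  \<open>partial\<close>. A proof of smoothness therefore only needs an invariant class of
  functions, and no formula for higher derivatives.\<close>

lemma smooth_coinduct:
  assumes "P f"
    and "\<And>g x. P g \<Longrightarrow> g differentiable (at x)"
    and "\<And>g i. P g \<Longrightarrow> P (partial i g)"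
  shows "smooth f"
proof -
  have "partials is g differentiable (at x)" if "P g" for "is" g x
    using that by (induction "is" arbitrary: g) (simp_all add: assms(2,3))
  then show ?thesis
    using assms(1) by (simp add: smooth_def)
qed

lemma partial_eqI:
  assumes "\<And>x. (f has_derivative D x) (at x)"
  shows "partial i f = (\<lambda>x. D x (axis i 1))"
  unfolding partial_def using frechet_derivative_at[OF assms] by metis

lemma partial_add:
  assumes "\<And>x. f differentiable (at x)" "\<And>x. g differentiable (at x)"
  shows "partial i (\<lambda>x. f x + g x) = (\<lambda>x. partial i f x + partial i g x)"
  unfolding partial_def[of i f] partial_def[of i g]
  by (rule partial_eqI has_derivative_add assms[unfolded frechet_derivative_works])+

lemma partial_mult:
  fixes f g :: "real ^ 'n \<Rightarrow> 'c::real_normed_field"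
  assumes "\<And>x. f differentiable (at x)" "\<And>x. g differentiable (at x)"
  shows "partial i (\<lambda>x. f x * g x) = (\<lambda>x. f x * partial i g x + partial i f x * g x)"
  unfolding partial_def[of i f] partial_def[of i g]
  by (rule partial_eqI has_derivative_mult assms[unfolded frechet_derivative_works])+

text \<open>Closed under pointwise sums and products only, the two operations through which the sum
  and Leibniz rules express derivatives.\<close>

inductive_set ring_hull :: "('x \<Rightarrow> 'c::ring) set \<Rightarrow> ('x \<Rightarrow> 'c) set" for S where
  base: "g \<in> S \<Longrightarrow> g \<in> ring_hull S"
| add: "g \<in> ring_hull S \<Longrightarrow> h \<in> ring_hull S \<Longrightarrow> (\<lambda>x. g x + h x) \<in> ring_hull S"
| mult: "g \<in> ring_hull S \<Longrightarrow> h \<in> ring_hull S \<Longrightarrow> (\<lambda>x. g x * h x) \<in> ring_hull S"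

text \<open>The sum and Leibniz rules carry differentiability and stability under
  \<open>partial\<close> from the generators to the whole hull, which then serves as the invariant
  of \<open>smooth_coinduct\<close>.\<close>

lemma smooth_ring_hull:
  fixes S :: "(real ^ 'n \<Rightarrow> 'c::real_normed_field) set"
  assumes "\<And>g x. g \<in> S \<Longrightarrow> g differentiable (at x)"
    and "\<And>g i. g \<in> S \<Longrightarrow> partial i g \<in> ring_hull S"
    and "f \<in> ring_hull S"
  shows "smooth f"
proof -
  have diff: "g differentiable (at x)" if "g \<in> ring_hull S" for g x
    using that by induction (auto intro: assms)
  have part: "partial i g \<in> ring_hull S" if "g \<in> ring_hull S" for g i
    using that
    by induction (auto simp: partial_add partial_mult diff intro: assms ring_hull.intros)
  show ?thesis
    by (rule smooth_coinduct[of "\<lambda>g. g \<in> ring_hull S"]) (use assms(3) diff part in auto)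
qed

lemma
  fixes f g :: "real ^ 'n \<Rightarrow> 'c::real_normed_field"
  assumes "smooth f" "smooth g"
  shows smooth_add: "smooth (\<lambda>x. f x + g x)" and smooth_mult: "smooth (\<lambda>x. f x * g x)"
proof -
  \<comment> \<open>With all smooth functions as generators, each partial derivative of a generator
    is again a generator.\<close>
  have *: "smooth h" if "h \<in> ring_hull {f. smooth f}" for h :: "real ^ 'n \<Rightarrow> 'c"
    by (rule smooth_ring_hull[OF _ _ that])
      (auto intro: smooth_differentiable smooth_partial ring_hull.base)
  have "f \<in> ring_hull {f. smooth f}" "g \<in> ring_hull {f. smooth f}"
    using assms by (auto intro: ring_hull.base)
  then show "smooth (\<lambda>x. f x + g x)" "smooth (\<lambda>x. f x * g x)"
    by (blast intro: * ring_hull.add ring_hull.mult)+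
qed

lemma smooth_const: "smooth (\<lambda>x. a)"
proof (rule smooth_coinduct[of "\<lambda>g. \<exists>a. g = (\<lambda>x. a)"])
  show "\<exists>b. partial i g = (\<lambda>x. b)" if "\<exists>a. g = (\<lambda>x. a)" for g :: "real ^ 'a \<Rightarrow> 'b" and i
    using that by (auto simp: partial_def)
qed auto

lemma partial_of_real:
  assumes "\<And>x. f differentiable (at x)"
  shows "partial i (\<lambda>x. of_real (f x)) = (\<lambda>x. of_real (partial i f x))"
  unfolding partial_def[of i f]
  by (rule partial_eqI has_derivative_of_real assms[unfolded frechet_derivative_works])+

lemma smooth_of_real:
  assumes "smooth f"
  shows "smooth (\<lambda>x. of_real (f x) :: 'c::{real_normed_field})"
proof (rule smooth_coinduct[of "\<lambda>g. \<exists>f. smooth f \<and> g = (\<lambda>x. of_real (f x))"])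
  fix g :: "real ^ 'a \<Rightarrow> 'c" and i x
  assume "\<exists>f. smooth f \<and> g = (\<lambda>x. of_real (f x))"
  then obtain f where f: "smooth f" "g = (\<lambda>x. of_real (f x))"
    by blast
  show "g differentiable (at x)"
    using has_derivative_of_real[OF smooth_differentiable[OF f(1), unfolded frechet_derivative_works]]
    unfolding f differentiable_def by blast
  show "\<exists>f. smooth f \<and> partial i g = (\<lambda>x. of_real (f x))"
    using f partial_of_real[of f i] smooth_differentiable smooth_partial by metis
qed (use assms in auto)

text \<open>The derivative of \<open>r = 1 / sqrt c\<close> is \<open>- 1 / 2 * r * r * r\<close>
  times that of \<open>c\<close>, hence a product of \<open>r\<close> and smooth functions. So
  \<open>r\<close> together with all smooth functions generates a hull stable under
  \<open>partial\<close>; \<open>sqrt c = c * r\<close> then follows suit.\<close>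

lemma
  assumes "smooth c" and pos: "\<And>x. c x > 0"
  shows smooth_inverse_sqrt: "smooth (\<lambda>x. inverse (sqrt (c x)))"
    and smooth_sqrt: "smooth (\<lambda>x. sqrt (c x))"
proof -
  define r where "r = (\<lambda>x. inverse (sqrt (c x)))"
  define D where "D = (\<lambda>x h. r x * (r x * r x) * (- 1 / 2 * frechet_derivative c (at x) h))"
  have deriv: "(r has_derivative D x) (at x)" for x
  proof -
    have "((\<lambda>u. inverse (sqrt u)) has_real_derivative r x * (r x * r x) * (- 1 / 2)) (at (c x))"
      using DERIV_inverse'[OF DERIV_real_sqrt[OF pos]] pos[of x]
      by (auto simp: r_def mult_ac less_imp_neq[THEN not_sym])
    from DERIV_compose_FDERIV[OF this smooth_differentiable[OF assms(1), unfolded frechet_derivative_works]]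
    show ?thesis
      by (simp add: r_def D_def mult_ac)
  qed
  have "smooth r"
  proof (rule smooth_ring_hull[of "insert r {g. smooth g}"])
    fix g i x
    assume g: "g \<in> insert r {g. smooth g}"
    show "g differentiable (at x)"
      using g deriv smooth_differentiable differentiable_def by blast
    define h where "h = (\<lambda>x. (- 1 / 2) * partial i c x)"
    have "smooth h"
      unfolding h_def by (intro smooth_mult smooth_const smooth_partial assms)
    then have "(\<lambda>x. r x * (r x * r x) * h x) \<in> ring_hull (insert r {g. smooth g})"
      by (intro ring_hull.mult ring_hull.base) auto
    moreover have "partial i r = (\<lambda>x. r x * (r x * r x) * h x)"
      using partial_eqI[OF deriv] by (simp add: D_def h_def partial_def)
    ultimately have "partial i r \<in> ring_hull (insert r {g. smooth g})"
      by simp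
    then show "partial i g \<in> ring_hull (insert r {g. smooth g})"
      using g smooth_partial[of g i] by (auto simp: ring_hull.base)
  qed (auto intro: ring_hull.base)
  then show "smooth (\<lambda>x. inverse (sqrt (c x)))"
    by (simp add: r_def)
  have "(\<lambda>x. sqrt (c x)) = (\<lambda>x. c x * r x)"
    using pos by (auto simp: r_def fun_eq_iff less_imp_le real_div_sqrt simp flip: divide_inverse)
  then show "smooth (\<lambda>x. sqrt (c x))"
    using smooth_mult[OF assms(1) \<open>smooth r\<close>] by simp
qed

lemma test_convergent_partial:
  "test_convergent \<Phi> \<phi> \<Longrightarrow> test_convergent (\<lambda>n. partial i (\<Phi> n)) (partial i \<phi>)"
  unfolding test_convergent_def by (simp flip: partials_Cons)

lemma partials_add:
  fixes f g :: "real ^ 'n \<Rightarrow> 'c::real_normed_field"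
  assumes "smooth f" "smooth g"
  shows "partials is (\<lambda>x. f x + g x) = (\<lambda>x. partials is f x + partials is g x)"
  using assms
  by (induction "is" arbitrary: f g)
    (simp_all add: partial_add smooth_differentiable smooth_partial)

subsection \<open>Periodic functions\<close>

lemma periodicD: "periodic f \<Longrightarrow> m \<in> integer_vectors \<Longrightarrow> f (x + m) = f x"
  by (simp add: periodic_def)

lemma axis_integer_vectors: "axis i 1 \<in> integer_vectors"
  by (simp add: integer_vectors_def axis_def)

text \<open>Differentiate \<open>f (y + m) = f y\<close> in \<open>y\<close> and use uniqueness of
  the derivative.\<close>

lemma periodic_partial:
  assumes "periodic f" "\<And>x. f differentiable (at x)"
  shows "periodic (partial i f)"
  unfolding periodic_def
proof safe
  fix m x :: "real ^ 'a"
  assume m: "m \<in> integer_vectors"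
  have "((\<lambda>y. f (y + m)) has_derivative frechet_derivative f (at (x + m))) (at x)"
    by (rule has_derivative_compose[where f = "\<lambda>y. y + m" and g = f, OF _ assms(2)[unfolded frechet_derivative_works], of "\<lambda>h. h", simplified])
      (auto intro!: derivative_eq_intros)
  then have "(f has_derivative frechet_derivative f (at (x + m))) (at x)"
    using periodicD[OF assms(1) m] by simp
  then show "partial i f (x + m) = partial i f x"
    using frechet_derivative_at unfolding partial_def by metis
qed

lemma test_functions_partials:
  assumes "\<phi> \<in> test_functions"
  shows "partials is \<phi> \<in> test_functions"
  using assms
  by (induction "is" arbitrary: \<phi>)
    (auto simp: test_functions_def periodic_partial smooth_partial smooth_differentiable)

lemma test_functions_continuous: "test_functions \<subseteq> continuous_functions"
  by (auto simp: test_functions_def continuous_functions_def smooth_continuous_on)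

text \<open>Floors and fractional parts of the coordinates: periodic functions are thus controlled
  by their values on a compact cube.\<close>

lemma unit_cube_decomposition:
  fixes x :: "real ^ 'n"
  obtains m y where "m \<in> integer_vectors" "y \<in> cbox 0 1" "x = y + m"
proof
  show "(\<chi> i. of_int \<lfloor>x $ i\<rfloor>) \<in> integer_vectors"
    by (simp add: integer_vectors_def)
  show "(\<chi> i. frac (x $ i)) \<in> cbox 0 1"
    by (auto simp: mem_box_cart frac_ge_0 frac_lt_1 less_imp_le)
  show "x = (\<chi> i. frac (x $ i)) + (\<chi> i. of_int \<lfloor>x $ i\<rfloor>)"
    by (simp add: vec_eq_iff frac_def)
qed

lemma continuous_functions_bounded:
  assumes "f \<in> continuous_functions"
  obtains B where "\<And>x. norm (f x) \<le> B"
proof -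
  have "continuous_on (cbox 0 1) f"
    using assms continuous_on_subset by (auto simp: continuous_functions_def)
  then have "compact (f ` cbox 0 1)"
    using compact_continuous_image compact_cbox by blast
  then obtain B where B: "\<And>y. y \<in> cbox 0 1 \<Longrightarrow> norm (f y) \<le> B"
    using compact_imp_bounded bounded_iff by (metis imageI)
  have "norm (f x) \<le> B" for x
  proof -
    obtain m y where "m \<in> integer_vectors" "y \<in> cbox 0 1" "x = y + m"
      by (rule unit_cube_decomposition)
    then show ?thesis
      using assms B by (simp add: continuous_functions_def periodicD)
  qed
  then show thesis ..
qed

lemma continuous_functions_uniform:
  fixes f :: "real ^ 'n \<Rightarrow> complex"
  assumes "f \<in> continuous_functions" "\<epsilon> > 0"
  obtains \<delta> where "\<delta> > 0" "\<And>x t. \<bar>t\<bar> < \<delta> \<Longrightarrow> norm (f (x + t *\<^sub>R axis i 1) - f x) < \<epsilon>"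
proof -
  \<comment> \<open>The enlarged cube contains every translate of a point of the unit cube by less
    than 1 along an axis; this is also why 1 enters the bound \<open>min \<delta> 1\<close>.\<close>
  have "continuous_on (cbox (vec (-1)) (vec 2)) f"
    using assms continuous_on_subset by (auto simp: continuous_functions_def)
  then have "uniformly_continuous_on (cbox (vec (-1)) (vec 2)) f"
    using compact_uniformly_continuous compact_cbox by blast
  then obtain \<delta> where \<delta>: "\<delta> > 0"
    "\<And>y z. y \<in> cbox (vec (-1)) (vec 2) \<Longrightarrow> z \<in> cbox (vec (-1)) (vec 2) \<Longrightarrow> dist z y < \<delta> \<Longrightarrow> dist (f z) (f y) < \<epsilon>"
    using \<open>\<epsilon> > 0\<close> unfolding uniformly_continuous_on_def by metis
  show thesis
  proof
    show "min \<delta> 1 > 0"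
      using \<delta> by simp
    fix x :: "real ^ 'n" and t :: real
    assume t: "\<bar>t\<bar> < min \<delta> 1"
    have per: "periodic f"
      using assms by (simp add: continuous_functions_def)
    obtain m y where my: "m \<in> integer_vectors" "y \<in> cbox 0 1" "x = y + m"
      by (rule unit_cube_decomposition)
    have y01: "0 \<le> y $ j" "y $ j \<le> 1" for j
      using my(2) by (auto simp: mem_box_cart)
    have "-1 \<le> (y + s *\<^sub>R axis i 1) $ j \<and> (y + s *\<^sub>R axis i 1) $ j \<le> 2" if "\<bar>s\<bar> < 1" for s j
      using y01[of j] that by (auto simp: axis_def)
    from this[of t] this[of 0]
    have "y \<in> cbox (vec (-1)) (vec 2)" "y + t *\<^sub>R axis i 1 \<in> cbox (vec (-1)) (vec 2)"
      using t by (auto simp: mem_box_cart)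
    moreover have "dist (y + t *\<^sub>R axis i 1) y < \<delta>"
      using t by (simp add: dist_norm)
    ultimately have "dist (f (y + t *\<^sub>R axis i 1)) (f y) < \<epsilon>"
      using \<delta> by blast
    then show "norm (f (x + t *\<^sub>R axis i 1) - f x) < \<epsilon>"
      using periodicD[OF per my(1)] my(3)
      by (metis add.assoc add.commute dist_norm)
  qed
qed

text \<open>Induction on the list of derivatives by the Leibniz rule, with both factors generalized
  because each derivative may fall on either. Applied to \<open>sqrt c\<close>, this makes the
  conformal weight continuous on test functions.\<close>

lemma test_convergent_mult:
  assumes "g \<in> test_functions" "\<phi> \<in> test_functions" "\<And>n. \<Phi> n \<in> test_functions"
    and "test_convergent \<Phi> \<phi>"
  shows "test_convergent (\<lambda>n x. g x * \<Phi> n x) (\<lambda>x. g x * \<phi> x)"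
proof -
  have "uniform_limit UNIV (\<lambda>n. partials is (\<lambda>x. g x * \<Phi> n x)) (partials is (\<lambda>x. g x * \<phi> x)) sequentially"
    for "is"
    using assms
  proof (induction "is" arbitrary: g \<phi> \<Phi>)
    case Nil
    \<comment> \<open>Uniform limits multiply when the limit functions are bounded, which
      periodicity and continuity supply.\<close>
    obtain B C where "\<And>x. norm (g x) \<le> B" "\<And>x. norm (\<phi> x) \<le> C"
      using continuous_functions_bounded Nil test_functions_continuous by (metis subsetD)
    then have "bounded (range g)" "bounded (range \<phi>)"
      by (auto simp: bounded_iff)
    moreover have "uniform_limit UNIV \<Phi> \<phi> sequentially"
      using Nil.prems(4)[unfolded test_convergent_def, rule_format, of "[]"] by simp
    ultimately show ?case
      using uniform_lim_mult[OF uniform_limit_const] by (simp add: partials_def)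
  next
    case (Cons i "is")
    have sm: "smooth g" "smooth \<phi>" "\<And>n. smooth (\<Phi> n)"
      using Cons.prems by (auto simp: test_functions_def)
    have tf: "partial i h \<in> test_functions" if "h \<in> test_functions" for h :: "real ^ 'a \<Rightarrow> complex"
      using test_functions_partials[OF that, of "[i]"] by simp
    have *: "partials (i # is) (\<lambda>x. g x * h x) =
        (\<lambda>x. partials is (\<lambda>x. g x * partial i h x) x + partials is (\<lambda>x. partial i g x * h x) x)"
      if "smooth h" for h
      using that sm(1) by (simp add: partial_mult partials_add smooth_mult smooth_partial smooth_differentiable)
    show ?case
      unfolding *[OF sm(2)] *[OF sm(3)]
      by (intro uniform_limit_add Cons.IH test_convergent_partial tf Cons.prems)
  qed
  then show ?thesis
    by (simp add: test_convergent_def)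
qed

subsection \<open>Weighted averages along lines\<close>

text \<open>A common form of three operators: \<open>g = 1\<close> gives the X-ray transform, a
  character gives a partial Fourier mode, and the Fejer kernel gives a Fejer mean.\<close>

definition line_average ::
    "(real \<Rightarrow> complex) \<Rightarrow> real ^ 'n \<Rightarrow> (real ^ 'n \<Rightarrow> complex) \<Rightarrow> real ^ 'n \<Rightarrow> complex" where
  "line_average g w f = (\<lambda>x. integral {0..1} (\<lambda>t. g t * f (x + t *\<^sub>R w)))"

lemma line_integral_eq: "line_integral v f = line_average (\<lambda>_. 1) v f"
  by (simp add: line_integral_def line_average_def)

lemma continuous_on_line:
  fixes f :: "'v::real_normed_vector \<Rightarrow> complex"
  assumes "continuous_on UNIV f" "continuous_on UNIV g"
  shows "continuous_on A (\<lambda>t. g t * f (x + t *\<^sub>R w))"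
  by (intro continuous_on_mult continuous_on_compose2[OF assms(1)] continuous_on_subset[OF assms(2)])
    (auto intro!: continuous_intros)

lemma integrable_line:
  fixes f :: "'v::real_normed_vector \<Rightarrow> complex"
  assumes "continuous_on UNIV f" "continuous_on UNIV g"
  shows "(\<lambda>t. g t * f (x + t *\<^sub>R w)) integrable_on {0..1}"
  using continuous_on_line[OF assms] by (rule integrable_continuous_real)

lemma continuous_on_line_average:
  assumes "continuous_on UNIV f" "continuous_on UNIV g"
  shows "continuous_on UNIV (line_average g w f)"
proof -
  have "continuous_on (UNIV \<times> cbox 0 1) (\<lambda>(x, t). g t * f (x + t *\<^sub>R w))"
    unfolding split_beta
    by (intro continuous_intros continuous_on_compose2[OF assms(1)] continuous_on_compose2[OF assms(2)]) auto
  from integral_continuous_on_param[OF this] show ?thesis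
    by (simp add: line_average_def)
qed

lemma periodic_line_average: "periodic f \<Longrightarrow> periodic (line_average g w f)"
  by (simp add: periodic_def line_average_def algebra_simps)

lemma line_average_continuous_functions:
  assumes "f \<in> continuous_functions" "continuous_on UNIV g"
  shows "line_average g w f \<in> continuous_functions"
  using assms continuous_on_line_average periodic_line_average by (auto simp: continuous_functions_def)

text \<open>Fubini on the unit square, as translations along \<open>v\<close> and \<open>w\<close>
  commute.\<close>

lemma line_average_commute:
  assumes "continuous_on UNIV f" "continuous_on UNIV g" "continuous_on UNIV h"
  shows "line_average g v (line_average h w f) = line_average h w (line_average g v f)"
proof
  fix x
  have "continuous_on (cbox (0, 0) (1, 1)) (\<lambda>(s, t). g s * (h t * f (x + s *\<^sub>R v + t *\<^sub>R w)))"
    unfolding split_beta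
    by (intro continuous_intros continuous_on_compose2[OF assms(1)] continuous_on_compose2[OF assms(2)]
        continuous_on_compose2[OF assms(3)]) auto
  from integral_swap_continuous[OF this]
  show "line_average g v (line_average h w f) x = line_average h w (line_average g v f) x"
    by (simp add: line_average_def mult_ac add_ac flip: integral_mult_right)
qed

text \<open>Differentiation under the integral sign. The integrand has a derivative that is jointly
  continuous in \<open>x\<close> and \<open>t\<close> as a bounded linear map, which is what the
  Leibniz rule for parameter integrals asks for.\<close>

lemma has_derivative_line_average:
  fixes f :: "real ^ 'n \<Rightarrow> complex"
  assumes "smooth f" "continuous_on UNIV g"
  shows "(line_average g w f has_derivative
    (\<lambda>h. \<Sum>i\<in>UNIV. h $ i *\<^sub>R line_average g w (partial i f) x)) (at x)"
proof -
  \<comment> \<open>\<open>F\<close> is the derivative of \<open>f\<close> assembled from its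
    partial derivatives, so that its continuity in operator norm follows from theirs.\<close>
  define F where "F = (\<lambda>x. \<Sum>i\<in>UNIV. blinfun_scaleR_left (partial i f x) o\<^sub>L blinfun_inner_right (axis i (1::real)))"
  have F: "blinfun_apply (F x) h = (\<Sum>i\<in>UNIV. h $ i *\<^sub>R partial i f x)" for x h
    by (simp add: F_def blinfun.sum_left inner_axis inner_commute)
  have deriv: "(f has_derivative blinfun_apply (F x)) (at x)" for x
  proof -
    have D: "(f has_derivative frechet_derivative f (at x)) (at x)"
      using smooth_differentiable[OF assms(1)] frechet_derivative_works by blast
    then have lin: "linear (frechet_derivative f (at x))"
      by (rule has_derivative_linear)
    have "frechet_derivative f (at x) h = blinfun_apply (F x) h" for h
    proof -
      have "frechet_derivative f (at x) h = frechet_derivative f (at x) (\<Sum>i\<in>UNIV. h $ i *\<^sub>R axis i 1)"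
        using basis_expansion[of h] by (simp add: scalar_mult_eq_scaleR)
      then show ?thesis
        by (simp add: F partial_def linear_sum[OF lin] linear_scale[OF lin])
    qed
    with D show ?thesis
      by (metis ext)
  qed
  have contF: "continuous_on UNIV F"
    unfolding F_def
    by (intro continuous_intros bounded_linear.continuous_on[OF bounded_linear_blinfun_scaleR_left]
        smooth_continuous_on smooth_partial assms(1))
  have "((\<lambda>x. integral (cbox 0 1) (\<lambda>t. g t * f (x + t *\<^sub>R w))) has_derivative
      integral (cbox 0 1) (\<lambda>t. blinfun_mult_right (g t) o\<^sub>L F (x + t *\<^sub>R w))) (at x within UNIV)"
  proof (rule leibniz_rule)
    fix x t
    have "((\<lambda>x. f (x + t *\<^sub>R w)) has_derivative blinfun_apply (F (x + t *\<^sub>R w))) (at x)"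
      by (rule has_derivative_compose[where f = "\<lambda>y. y + t *\<^sub>R w" and g = f, OF _ deriv, of "\<lambda>h. h", simplified])
        (auto intro!: derivative_eq_intros)
    from has_derivative_mult_right[OF this, of "g t"]
    show "((\<lambda>x. g t * f (x + t *\<^sub>R w)) has_derivative
        blinfun_apply (blinfun_mult_right (g t) o\<^sub>L F (x + t *\<^sub>R w))) (at x within UNIV)"
      by (simp add: blinfun_compose.rep_eq o_def)
  next
    show "continuous_on (UNIV \<times> cbox 0 1) (\<lambda>(x, t). blinfun_mult_right (g t) o\<^sub>L F (x + t *\<^sub>R w))"
      unfolding split_beta
      by (intro continuous_intros bounded_linear.continuous_on[OF bounded_linear_blinfun_mult_right]
          continuous_on_compose2[OF contF] continuous_on_compose2[OF assms(2)]) auto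
  qed (use integrable_line[OF smooth_continuous_on[OF assms(1)] assms(2)] in auto)
  note deriv_avg = this
  have "blinfun_apply (integral (cbox 0 1) (\<lambda>t. blinfun_mult_right (g t) o\<^sub>L F (x + t *\<^sub>R w))) h =
      (\<Sum>i\<in>UNIV. h $ i *\<^sub>R line_average g w (partial i f) x)" for h
  proof -
    have "(\<lambda>t. blinfun_mult_right (g t) o\<^sub>L F (x + t *\<^sub>R w)) integrable_on cbox 0 1"
      by (intro integrable_continuous continuous_intros bounded_linear.continuous_on[OF bounded_linear_blinfun_mult_right]
          continuous_on_compose2[OF contF] continuous_on_compose2[OF assms(2)]) auto
    then have "blinfun_apply (integral (cbox 0 1) (\<lambda>t. blinfun_mult_right (g t) o\<^sub>L F (x + t *\<^sub>R w))) h =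
       integral (cbox 0 1) (\<lambda>t. g t * (\<Sum>i\<in>UNIV. h $ i *\<^sub>R partial i f (x + t *\<^sub>R w)))"
      by (simp add: blinfun_apply_integral F)
    also have "\<dots> = integral {0..1} (\<lambda>t. \<Sum>i\<in>UNIV. h $ i *\<^sub>R (g t * partial i f (x + t *\<^sub>R w)))"
      by (simp add: sum_distrib_left)
    also have "\<dots> = (\<Sum>i\<in>UNIV. h $ i *\<^sub>R line_average g w (partial i f) x)"
      unfolding line_average_def
      by (subst integral_sum)
        (auto intro!: integrable_cmul integrable_line smooth_continuous_on smooth_partial assms)
    finally show ?thesis .
  qed
  then have *: "blinfun_apply (integral (cbox 0 1) (\<lambda>t. blinfun_mult_right (g t) o\<^sub>L F (x + t *\<^sub>R w))) =
      (\<lambda>h. \<Sum>i\<in>UNIV. h $ i *\<^sub>R line_average g w (partial i f) x)"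
    by blast
  show ?thesis
    using deriv_avg unfolding * by (simp add: line_average_def[abs_def])
qed

lemma partial_line_average:
  assumes "smooth f" "continuous_on UNIV g"
  shows "partial i (line_average g w f) = line_average g w (partial i f)"
  using partial_eqI[OF has_derivative_line_average[OF assms]]
  by (simp add: axis_def if_distrib[of "\<lambda>r. r *\<^sub>R _"] cong: if_cong)

lemma smooth_line_average:
  assumes "smooth f" "continuous_on UNIV g"
  shows "smooth (line_average g w f)"
proof (rule smooth_coinduct[of "\<lambda>F. \<exists>f. smooth f \<and> F = line_average g w f"])
  show "F differentiable (at x)" if "\<exists>f. smooth f \<and> F = line_average g w f" for F x
    using that has_derivative_line_average assms(2) differentiable_def by blast
  show "\<exists>f. smooth f \<and> partial i F = line_average g w f" if "\<exists>f. smooth f \<and> F = line_average g w f" for F i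
    using that partial_line_average assms(2) smooth_partial by blast
qed (use assms in auto)

lemma partials_line_average:
  assumes "smooth f" "continuous_on UNIV g"
  shows "partials is (line_average g w f) = line_average g w (partials is f)"
  using assms(1)
  by (induction "is" arbitrary: f) (simp_all add: partial_line_average[OF _ assms(2)] smooth_partial)

lemma line_average_test_functions:
  assumes "f \<in> test_functions" "continuous_on UNIV g"
  shows "line_average g w f \<in> test_functions"
  using assms smooth_line_average periodic_line_average by (auto simp: test_functions_def)

subsection \<open>Partial Fourier modes and Fejer means\<close>

text \<open>For \<open>0 \<le> s \<le> 1\<close>, cut \<open>{s..s + 1}\<close> at 1 and move the
  right piece back by one period; a general \<open>s\<close> reduces to
  \<open>frac s\<close>.\<close>

lemma integral_periodic_shift:
  fixes G :: "real \<Rightarrow> complex"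
  assumes "continuous_on UNIV G" "\<And>t. G (t + 1) = G t"
  shows "integral {0..1} (\<lambda>t. G (t + s)) = integral {0..1} G"
proof -
  have int: "G integrable_on {a..b}" for a b
    using assms(1) continuous_on_subset integrable_continuous_real by blast
  have "integral {0..1} (\<lambda>t. G (t + s)) = integral {0..1} G" if "0 \<le> s" "s \<le> 1" for s
  proof -
    have "integral {0..1} (\<lambda>t. G (t + s)) = integral {s..s + 1} G"
      using integral_shift_real_ivl[of s s "s + 1" G] by simp
    also have "\<dots> = integral {s..1} G + integral {1..s + 1} G"
      using that Henstock_Kurzweil_Integration.integral_combine[OF _ _ int, of s 1 "s + 1"] by simp
    also have "integral {1..s + 1} G = integral {0..s} G"
      using integral_shift_real_ivl[of 1 1 "s + 1" G] assms(2) by simp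
    also have "integral {s..1} G + integral {0..s} G = integral {0..1} G"
      using that Henstock_Kurzweil_Integration.integral_combine[OF _ _ int, of 0 s 1] by (simp add: add.commute)
    finally show ?thesis .
  qed
  moreover have "G (t + of_int n) = G t" for t n
  proof (induction n rule: int_induct[where k = 0])
    case (step1 i)
    then show ?case using assms(2)[of "t + of_int i"] by (simp add: add_ac)
  next
    case (step2 i)
    then show ?case using assms(2)[of "t + of_int i - 1"] by (simp add: algebra_simps)
  qed simp
  then have "G (t + s) = G (t + frac s)" for t
    by (metis (no_types) add.assoc add.commute frac_def diff_add_cancel)
  ultimately show ?thesis
    using frac_ge_0[of s] frac_lt_1[of s] by simp
qed

text \<open>The projection to frequency \<open>m\<close> in the single variable \<open>i\<close>:
  the usual Fourier coefficient in that variable times the character of frequency \<open>m\<close>.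
  It remains a function of all variables, so it can be iterated over the coordinates.\<close>

definition fourier_mode :: "'n \<Rightarrow> int \<Rightarrow> (real ^ 'n \<Rightarrow> complex) \<Rightarrow> real ^ 'n \<Rightarrow> complex" where
  "fourier_mode i m = line_average (\<lambda>t. cis (2 * pi * (- m * t))) (axis i 1)"

lemma continuous_on_cis_linear: "continuous_on A (\<lambda>t. cis (2 * pi * (a * t)))"
  by (intro continuous_intros)

text \<open>Substitute \<open>t + s\<close> for \<open>t\<close>; the integrand \<open>G\<close> has
  period 1 because \<open>m\<close> is an integer, so the interval of integration need not
  move.\<close>

lemma fourier_mode_shift:
  assumes "f \<in> continuous_functions"
  shows "fourier_mode i m f (x + s *\<^sub>R axis i 1) = cis (2 * pi * (m * s)) * fourier_mode i m f x"
proof -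
  define G where "G = (\<lambda>t :: real. cis (2 * pi * (- m * t)) * f (x + t *\<^sub>R axis i 1))"
  have per: "periodic f" and cont: "continuous_on UNIV f"
    using assms by (auto simp: continuous_functions_def)
  have "cis (2 * pi * (- m * (t + 1))) = cis (2 * pi * (- m * t)) * cis (2 * pi * of_int (- m))" for t :: real
    by (simp add: cis_mult algebra_simps)
  then have "cis (2 * pi * (- m * (t + 1))) = cis (2 * pi * (- m * t))" for t :: real
    by (simp only: cis_multiple_2pi[OF Ints_of_int] mult_1_right)
  moreover have "f (x + (t + 1) *\<^sub>R axis i 1) = f (x + t *\<^sub>R axis i 1)" for t
    using periodicD[OF per axis_integer_vectors, of "x + t *\<^sub>R axis i 1" i]
    by (simp add: scaleR_add_left add_ac)
  ultimately have "G (t + 1) = G t" for t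
    unfolding G_def by (simp only:)
  moreover have "continuous_on UNIV G"
    unfolding G_def by (intro continuous_on_line cont continuous_on_cis_linear)
  ultimately have "integral {0..1} (\<lambda>t. G (t + s)) = integral {0..1} G"
    by (intro integral_periodic_shift)
  moreover have "cis (2 * pi * (- m * t)) * f (x + s *\<^sub>R axis i 1 + t *\<^sub>R axis i 1) =
      cis (2 * pi * (m * s)) * G (t + s)" for t :: real
  proof -
    have "cis (2 * pi * (- m * t)) = cis (2 * pi * (m * s)) * cis (2 * pi * (- m * (t + s)))"
      by (simp add: cis_mult algebra_simps)
    then show ?thesis
      by (simp add: G_def scaleR_add_left add_ac mult.assoc)
  qed
  ultimately show ?thesis
    by (simp add: fourier_mode_def line_average_def G_def)
qed

text \<open>Orthogonality of characters on the circle. It yields both the total mass of the Fejer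
  kernel and the vanishing null integrals of the invisible character.\<close>

lemma integral_cis:
  "((\<lambda>t. cis (2 * pi * (of_int m * t))) has_integral (if m = 0 then 1 else 0)) {0..1}"
proof (cases "m = 0")
  case True
  then show ?thesis
    using has_integral_const_real[of "1::complex" 0 1] by simp
next
  case False
  define a where "a = 2 * pi * of_int m"
  have a: "a \<noteq> 0"
    using False by (simp add: a_def)
  have "((\<lambda>t. cis (a * t) / (\<i> * a)) has_vector_derivative cis (a * t)) (at t within {0..1})" for t
  proof -
    have "((\<lambda>z. exp (\<i> * a * z) / (\<i> * a)) has_field_derivative exp (\<i> * a * of_real t)) (at (of_real t))"
      by (rule derivative_eq_intros refl)+ (use a in auto)
    from has_vector_derivative_real_field[OF this, of "{0..1}"] show ?thesis
      by (simp add: cis_conv_exp mult.assoc)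
  qed
  then have "((\<lambda>t. cis (a * t)) has_integral (cis (a * 1) / (\<i> * a) - cis (a * 0) / (\<i> * a))) {0..1}"
    by (intro fundamental_theorem_of_calculus) auto
  moreover have "cis a = 1"
    by (simp add: a_def)
  ultimately have "((\<lambda>t. cis (a * t)) has_integral 0) {0..1}"
    by simp
  then show ?thesis
    using False by (simp add: a_def mult.assoc)
qed

text \<open>The Fejer kernel, the sum of
  \<open>(1 - \<bar>m\<bar> / (n + 1)) * cis (2 * pi * m * t)\<close> over
  \<open>\<bar>m\<bar> \<le> n\<close>, written as a normalized square so that positivity is
  immediate.\<close>

definition fejer :: "nat \<Rightarrow> real \<Rightarrow> real" where
  "fejer n t = (norm (\<Sum>j\<le>n. cis (2 * pi * (of_nat j * t))))\<^sup>2 / Suc n"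

lemma fejer_nonneg: "fejer n t \<ge> 0"
  by (simp add: fejer_def)

lemma continuous_on_fejer: "continuous_on A (fejer n)"
  unfolding fejer_def by (intro continuous_intros) auto

text \<open>Expand the squared norm as a sum over pairs. Equal frequencies are not collected, which
  avoids counting coefficients, and the sign is the one in the kernel of
  \<open>fourier_mode\<close>.\<close>

lemma fejer_eq_sum:
  "of_real (fejer n t) =
    (\<Sum>(j, l)\<in>{..n} \<times> {..n}. cis (2 * pi * (- of_int (int j - int l) * t)) / of_nat (Suc n))"
proof -
  define S where "S = (\<Sum>j\<le>n. cis (2 * pi * (of_nat j * t)))"
  have "of_real (fejer n t) = cnj S * S / of_nat (Suc n)"
    unfolding fejer_def S_def[symmetric] of_real_divide complex_norm_square by (simp add: mult.commute)
  also have "cnj S * S = (\<Sum>j\<le>n. \<Sum>l\<le>n. cis (- (2 * pi * (of_nat j * t))) * cis (2 * pi * (of_nat l * t)))"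
    unfolding S_def cnj_sum sum_product by (simp add: cis_cnj)
  also have "\<dots> = (\<Sum>(j, l)\<in>{..n} \<times> {..n}. cis (2 * pi * (- of_int (int j - int l) * t)))"
    by (simp add: sum.cartesian_product cis_mult algebra_simps)
  finally show ?thesis
    by (simp add: sum_divide_distrib split_beta)
qed

text \<open>Only the \<open>n + 1\<close> diagonal pairs have a non-zero integral, and each
  contributes \<open>1 / (n + 1)\<close>.\<close>

lemma has_integral_fejer: "(fejer n has_integral 1) {0..1}"
proof -
  have "((\<lambda>t. \<Sum>(j, l)\<in>{..n} \<times> {..n}. cis (2 * pi * (of_int (- (int j - int l)) * t)) / of_nat (Suc n))
      has_integral (\<Sum>(j, l)\<in>{..n} \<times> {..n}. (if - (int j - int l) = 0 then 1 else 0) / of_nat (Suc n))) {0..1}"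
    unfolding split_beta
    by (intro has_integral_sum has_integral_divide integral_cis) auto
  moreover have "(\<Sum>(j, l)\<in>{..n} \<times> {..n}. (if - (int j - int l) = 0 then 1 else 0) / of_nat (Suc n)) = (1 :: complex)"
  proof -
    have "(\<Sum>(j, l)\<in>{..n} \<times> {..n}. (if - (int j - int l) = 0 then 1 else 0) / of_nat (Suc n)) =
        (\<Sum>j\<le>n. \<Sum>l\<le>n. if j = l then 1 / of_nat (Suc n) else (0 :: complex))"
      unfolding sum.cartesian_product by (intro sum.cong) auto
    then show ?thesis
      by (simp add: field_simps of_nat_Suc[symmetric] del: of_nat_Suc)
  qed
  ultimately have "((\<lambda>t. of_real (fejer n t) :: complex) has_integral 1) {0..1}"
    unfolding fejer_eq_sum by simp
  from has_integral_Re[OF this] show ?thesis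
    by simp
qed

text \<open>Away from the integers \<open>norm (1 - z)\<close> has a positive lower bound
  \<open>b\<close>, where \<open>z = cis (2 * pi * t)\<close>. The geometric sum is then at most
  \<open>2 / b\<close> in norm, uniformly in \<open>n\<close>, whence
  \<open>C = 4 / b\<^sup>2\<close>.\<close>

lemma fejer_tail:
  assumes "\<delta> > 0"
  obtains C where "C > 0" "\<And>n t. \<delta> \<le> t \<Longrightarrow> t \<le> 1 - \<delta> \<Longrightarrow> fejer n t \<le> C / Suc n"
proof (cases "\<delta> \<le> 1 - \<delta>")
  \<comment> \<open>The range of \<open>t\<close> is empty here, so any positive constant will
    do.\<close>
  case False
  then show ?thesis
    by (intro that[of 1]) auto
next
  case True
  have "\<exists>t\<in>{\<delta>..1 - \<delta>}. \<forall>u\<in>{\<delta>..1 - \<delta>}. norm (1 - cis (2 * pi * t)) \<le> norm (1 - cis (2 * pi * u))"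
    using True by (intro continuous_attains_inf continuous_intros) auto
  then obtain t where t: "t \<in> {\<delta>..1 - \<delta>}"
    "\<And>u. u \<in> {\<delta>..1 - \<delta>} \<Longrightarrow> norm (1 - cis (2 * pi * t)) \<le> norm (1 - cis (2 * pi * u))"
    by blast
  define b where "b = norm (1 - cis (2 * pi * t))"
  have "cis (2 * pi * t) \<noteq> 1"
  \<comment> \<open>A zero of \<open>1 - cis (2 * pi * t)\<close> would make \<open>t\<close> an
    integer strictly between 0 and 1.\<close>
  proof
    assume "cis (2 * pi * t) = 1"
    then have "cos (2 * pi * t) = 1"
      by (simp add: complex_eq_iff)
    then obtain k :: int where "2 * pi * t = of_int k * 2 * pi"
      using cos_one_2pi_int by blast
    then have "t = of_int k"
      by simp
    with t(1) assms have "0 < real_of_int k" "real_of_int k < 1"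
      by auto
    then show False
      by simp
  qed
  then have b: "b > 0"
    by (simp add: b_def)
  show ?thesis
  proof
    show "4 / b\<^sup>2 > 0"
      using b by simp
    fix n u
    assume "\<delta> \<le> u" "u \<le> 1 - \<delta>"
    define z where "z = cis (2 * pi * u)"
    have z: "cis (2 * pi * (of_nat j * u)) = z ^ j" for j
      using Complex.DeMoivre[of "2 * pi * u" j] by (simp add: z_def mult_ac)
    have "b * norm (\<Sum>j\<le>n. z ^ j) \<le> norm (1 - z) * norm (\<Sum>j\<le>n. z ^ j)"
      using t(2)[of u] \<open>\<delta> \<le> u\<close> \<open>u \<le> 1 - \<delta>\<close> by (intro mult_right_mono) (auto simp: b_def z_def)
    also have "\<dots> = norm (1 - z ^ Suc n)"
      using sum_gp_basic[of z n] by (simp flip: norm_mult)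
    also have "\<dots> \<le> 2"
      using norm_triangle_ineq4[of 1 "z ^ Suc n"] by (simp add: norm_power z_def del: power_Suc)
    finally have "(b * norm (\<Sum>j\<le>n. z ^ j))\<^sup>2 \<le> 2\<^sup>2"
      using b by (intro power_mono) auto
    then have "(norm (\<Sum>j\<le>n. z ^ j))\<^sup>2 \<le> 4 / b\<^sup>2"
      using b by (simp add: field_simps power_mult_distrib)
    then show "fejer n u \<le> 4 / b\<^sup>2 / Suc n"
      unfolding fejer_def z by (rule divide_right_mono) simp
  qed
qed

section \<open>Fejer means in one variable and their convergence\<close>

definition fejer_mean :: "'n \<Rightarrow> nat \<Rightarrow> (real ^ 'n \<Rightarrow> complex) \<Rightarrow> real ^ 'n \<Rightarrow> complex" where
  "fejer_mean i n = line_average (\<lambda>t. of_real (fejer n t)) (axis i 1)"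

lemma fejer_mean_eq_sum:
  assumes "f \<in> continuous_functions"
  shows "fejer_mean i n f =
    (\<lambda>x. \<Sum>(j, l)\<in>{..n} \<times> {..n}. 1 / of_nat (Suc n) * fourier_mode i (int j - int l) f x)"
proof
  fix x
  have cont: "continuous_on UNIV f"
    using assms by (simp add: continuous_functions_def)
  have "fejer_mean i n f x = integral {0..1} (\<lambda>t. \<Sum>p\<in>{..n} \<times> {..n}. 1 / of_nat (Suc n) *
      (cis (2 * pi * (- of_int (int (fst p) - int (snd p)) * t)) * f (x + t *\<^sub>R axis i 1)))"
    by (simp add: fejer_mean_def line_average_def fejer_eq_sum sum_distrib_right split_beta)
  also have "\<dots> = (\<Sum>p\<in>{..n} \<times> {..n}. 1 / of_nat (Suc n) * fourier_mode i (int (fst p) - int (snd p)) f x)"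
    unfolding fourier_mode_def line_average_def
    by (subst integral_sum)
      (auto intro!: integrable_on_mult_right integrable_line cont continuous_intros
        simp del: of_int_diff of_nat_Suc)
  finally show "fejer_mean i n f x =
      (\<Sum>(j, l)\<in>{..n} \<times> {..n}. 1 / of_nat (Suc n) * fourier_mode i (int j - int l) f x)"
    by (simp add: split_beta)
qed

text \<open>Fejer's theorem in the variable \<open>i\<close>. As the kernel is non-negative of mass
  1, the error averages \<open>f (x + t *\<^sub>R axis i 1) - f x\<close>: this is small for
  \<open>t\<close> near an integer by uniform continuity, and elsewhere the kernel itself is
  small.\<close>

lemma fejer_mean_uniform_limit:
  fixes f :: "real ^ 'n \<Rightarrow> complex"
  assumes f: "f \<in> continuous_functions"
  shows "uniform_limit UNIV (\<lambda>n. fejer_mean i n f) f sequentially"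
proof (rule uniform_limitI)
  fix \<epsilon> :: real
  assume "\<epsilon> > 0"
  have per: "periodic f" and cont: "continuous_on UNIV f"
    using f by (auto simp: continuous_functions_def)
  obtain B where B: "\<And>x. norm (f x) \<le> B"
    using continuous_functions_bounded[OF f] by blast
  then have "B \<ge> 0"
    using norm_ge_zero order_trans by blast
  obtain \<delta> where \<delta>: "\<delta> > 0" "\<And>x t. \<bar>t\<bar> < \<delta> \<Longrightarrow> norm (f (x + t *\<^sub>R axis i 1) - f x) < \<epsilon> / 2"
    using continuous_functions_uniform[OF f, of "\<epsilon> / 2" i] \<open>\<epsilon> > 0\<close> by auto
  obtain C where C: "C > 0" "\<And>n t. \<delta> \<le> t \<Longrightarrow> t \<le> 1 - \<delta> \<Longrightarrow> fejer n t \<le> C / Suc n"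
    using fejer_tail[OF \<delta>(1)] by blast
  have bound: "norm (fejer_mean i n f x - f x) \<le> \<epsilon> / 2 + 2 * B * C / Suc n" for n x
  proof -
    have "((\<lambda>t. of_real (fejer n t) * f x) has_integral (of_real 1 * f x)) {0..1}"
      by (intro has_integral_mult_left has_integral_of_real has_integral_fejer)
    moreover have "((\<lambda>t. of_real (fejer n t) * f (x + t *\<^sub>R axis i 1)) has_integral fejer_mean i n f x) {0..1}"
      unfolding fejer_mean_def line_average_def
      by (intro integrable_integral integrable_line cont continuous_intros continuous_on_fejer)
    from has_integral_diff[OF this calculation] have 1: "((\<lambda>t. of_real (fejer n t) * (f (x + t *\<^sub>R axis i 1) - f x)) has_integral
        (fejer_mean i n f x - f x)) {0..1}"
      by (simp add: right_diff_distrib)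
    \<comment> \<open>One integrable majorant for both regions: the first summand handles
      \<open>t\<close> near an integer, the second handles the tail.\<close>
    have 2: "((\<lambda>t. fejer n t * (\<epsilon> / 2) + 2 * B * C / Suc n) has_integral (1 * (\<epsilon> / 2) + 2 * B * C / Suc n)) {0..1}"
      using has_integral_const_real[of "2 * B * C / Suc n" 0 1]
      by (intro has_integral_add has_integral_mult_left has_integral_fejer) simp
    have "norm (of_real (fejer n t) * (f (x + t *\<^sub>R axis i 1) - f x)) \<le> fejer n t * (\<epsilon> / 2) + 2 * B * C / Suc n"
      if "t \<in> {0..1}" for t
    proof (cases "\<delta> \<le> t \<and> t \<le> 1 - \<delta>")
      case True
      have "norm (f (x + t *\<^sub>R axis i 1) - f x) \<le> 2 * B"
        using norm_triangle_ineq4[of "f (x + t *\<^sub>R axis i 1)" "f x"] B[of "x + t *\<^sub>R axis i 1"] B[of x] by linarith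
      then have "fejer n t * norm (f (x + t *\<^sub>R axis i 1) - f x) \<le> (C / Suc n) * (2 * B)"
        using True C fejer_nonneg[of n t] by (intro mult_mono) auto
      then show ?thesis
        using fejer_nonneg[of n t] \<open>\<epsilon> > 0\<close> by (simp add: norm_mult mult_ac add_increasing)
    next
      case False
      have "norm (f (x + t *\<^sub>R axis i 1) - f x) < \<epsilon> / 2"
      proof (cases "t < \<delta>")
        case True
        then show ?thesis using \<delta>(2)[of t x] that by simp
      next
        \<comment> \<open>Now \<open>t\<close> lies within \<open>\<delta>\<close> of 1, and
          periodicity allows \<open>t - 1\<close> in its place.\<close>
        case tail: False
        then have "norm (f (x + (t - 1) *\<^sub>R axis i 1) - f x) < \<epsilon> / 2"
          using \<delta>(2)[of "t - 1" x] that False by simp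
        moreover have "f (x + (t - 1) *\<^sub>R axis i 1) = f (x + t *\<^sub>R axis i 1)"
          using periodicD[OF per axis_integer_vectors, of "x + (t - 1) *\<^sub>R axis i 1" i]
          by (simp add: algebra_simps)
        ultimately show ?thesis by simp
      qed
      then have "fejer n t * norm (f (x + t *\<^sub>R axis i 1) - f x) \<le> fejer n t * (\<epsilon> / 2)"
        using fejer_nonneg[of n t] by (intro mult_left_mono) auto
      moreover have "0 \<le> 2 * B * C / Suc n"
        using C(1) \<open>B \<ge> 0\<close> by simp
      ultimately show ?thesis
        using fejer_nonneg[of n t] by (simp add: norm_mult)
    qed
    from integral_norm_bound_integral[OF has_integral_integrable[OF 1] has_integral_integrable[OF 2] this]
    show ?thesis
      using integral_unique[OF 1] integral_unique[OF 2] by simp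
  qed
  have "(\<lambda>n. 2 * B * C / Suc n) \<longlonglongrightarrow> 0"
    using tendsto_mult_right_zero[OF LIMSEQ_inverse_real_of_nat, of "2 * B * C"]
    by (simp add: divide_inverse)
  then have "\<forall>\<^sub>F n in sequentially. 2 * B * C / Suc n < \<epsilon> / 2"
    using \<open>\<epsilon> > 0\<close> by (intro order_tendstoD) auto
  then show "\<forall>\<^sub>F n in sequentially. \<forall>x\<in>UNIV. dist (fejer_mean i n f x) (f x) < \<epsilon>"
  proof eventually_elim
    case (elim n)
    then show ?case
      using bound[of n] unfolding dist_norm by (smt (verit) field_sum_of_halves)
  qed
qed

text \<open>Partial derivatives commute with line averages, so Fejer's theorem applies to each
  derivative separately.\<close>

lemma fejer_mean_test_convergent:
  assumes "\<phi> \<in> test_functions"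
  shows "test_convergent (\<lambda>n. fejer_mean i n \<phi>) \<phi>"
  unfolding test_convergent_def
proof
  fix "is"
  have "continuous_on UNIV (\<lambda>t. of_real (fejer n t) :: complex)" for n
    by (intro continuous_intros continuous_on_fejer)
  moreover have "smooth \<phi>"
    using assms by (simp add: test_functions_def)
  ultimately have "partials is (fejer_mean i n \<phi>) = fejer_mean i n (partials is \<phi>)" for n
    by (simp add: fejer_mean_def partials_line_average)
  moreover have "partials is \<phi> \<in> continuous_functions"
    using test_functions_partials[OF assms] test_functions_continuous by blast
  ultimately show "uniform_limit UNIV (\<lambda>n. partials is (fejer_mean i n \<phi>)) (partials is \<phi>) sequentially"
    using fejer_mean_uniform_limit by simp
qed

text \<open>
  Replacing a function by its partial Fourier modes one coordinate at a time reduces any property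
  that is stable under Fejer means to functions on which all translations act by a character.
\<close>

lemma fourier_mode_induct:
  fixes f :: "real ^ 'n \<Rightarrow> complex"
  assumes f: "f \<in> D" and D: "D \<subseteq> continuous_functions"
    and closed: "\<And>f i m. f \<in> D \<Longrightarrow> fourier_mode i m f \<in> D"
    and step: "\<And>f i. f \<in> D \<Longrightarrow> (\<And>m. Q (fourier_mode i m f)) \<Longrightarrow> Q f"
    and character: "\<And>f k. f \<in> D \<Longrightarrow> k \<in> integer_vectors \<Longrightarrow>
      (\<And>x y. f (x + y) = cis (2 * pi * (k \<bullet> y)) * f x) \<Longrightarrow> Q f"
  shows "Q f"
proof -
  \<comment> \<open>\<open>I\<close> holds the coordinates still to be treated; along every other
    axis \<open>f\<close> already transforms by the character recorded in \<open>m\<close>.\<close>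
  have "Q f" if "finite I" "f \<in> D"
    "\<And>i x s. i \<notin> I \<Longrightarrow> f (x + s *\<^sub>R axis i 1) = cis (2 * pi * (of_int (m i) * s)) * f x"
    for I f and m :: "'n \<Rightarrow> int"
    using that
  proof (induction I arbitrary: f m)
    case empty
    \<comment> \<open>With no coordinates left, a translation by \<open>y\<close> is composed of
      axis translations, whose phases multiply to a single character.\<close>
    have shift: "f (x + (\<Sum>i\<in>J. y $ i *\<^sub>R axis i 1)) = cis (2 * pi * (\<Sum>i\<in>J. of_int (m i) * y $ i)) * f x"
      if "finite J" for J x y
      using that
    proof (induction J)
      case (insert j J)
      have "f (x + (\<Sum>i\<in>J. y $ i *\<^sub>R axis i 1) + y $ j *\<^sub>R axis j 1) =
          cis (2 * pi * (of_int (m j) * y $ j)) * (cis (2 * pi * (\<Sum>i\<in>J. of_int (m i) * y $ i)) * f x)"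
        using insert.IH empty.prems(2) by simp
      moreover have "cis (2 * pi * (of_int (m j) * y $ j)) * cis (2 * pi * (\<Sum>i\<in>J. of_int (m i) * y $ i)) =
          cis (2 * pi * (\<Sum>i\<in>insert j J. of_int (m i) * y $ i))"
        using insert.hyps by (simp add: cis_mult distrib_left)
      ultimately show ?case
        using insert.hyps by (simp add: add_ac flip: mult.assoc)
    qed simp
    define k :: "real ^ 'n" where "k = (\<chi> i. of_int (m i))"
    show ?case
    proof (rule character[OF empty.prems(1)])
      show "k \<in> integer_vectors"
        by (simp add: k_def integer_vectors_def)
      show "f (x + y) = cis (2 * pi * (k \<bullet> y)) * f x" for x y
        using shift[of UNIV x y] basis_expansion[of y]
        by (simp add: scalar_mult_eq_scaleR inner_vec_def k_def)
    qed
  next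
    case (insert j J)
    show ?case
    proof (rule step[OF insert.prems(1)])
      fix l
      show "Q (fourier_mode j l f)"
      proof (rule insert.IH)
        show "fourier_mode j l f \<in> D"
          by (rule closed[OF insert.prems(1)])
        fix i x s
        assume i: "i \<notin> J"
        show "fourier_mode j l f (x + s *\<^sub>R axis i 1) =
            cis (2 * pi * (of_int ((m(j := l)) i) * s)) * fourier_mode j l f x"
        proof (cases "i = j")
          case True
          then show ?thesis
            using fourier_mode_shift[of f j l x s] insert.prems(1) D by auto
        next
          case False
          \<comment> \<open>The phase along axis \<open>i\<close> is independent of the integration
            variable along axis \<open>j\<close>, so it factors out and earlier characters
            survive.\<close>
          have "f (x + s *\<^sub>R axis i 1 + t *\<^sub>R axis j 1) =
              cis (2 * pi * (of_int (m i) * s)) * f (x + t *\<^sub>R axis j 1)" for t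
            using insert.prems(2)[of i "x + t *\<^sub>R axis j 1" s] i False by (simp add: add_ac)
          then show ?thesis
            using False
            by (simp add: fourier_mode_def line_average_def mult.left_commute)
        qed
      qed
    qed
  qed
  \<comment> \<open>For \<open>I = UNIV\<close> the transformation hypothesis is vacuous.\<close>
  from this[of UNIV] f show ?thesis
    by simp
qed

subsection \<open>Null vectors orthogonal to a frequency\<close>

lemma sum_UNIV_two:
  fixes F :: "'i::finite \<Rightarrow> 'c::comm_monoid_add"
  assumes "i \<noteq> j" "\<And>l. l \<noteq> i \<Longrightarrow> l \<noteq> j \<Longrightarrow> F l = 0"
  shows "sum F UNIV = F i + F j"
proof -
  have "sum F UNIV = sum F {i, j}"
    using assms(2) by (intro sum.mono_neutral_right) auto
  then show ?thesis
    using assms(1) by simp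
qed

lemma inner_sum_type:
  fixes v w :: "real ^ ('a::finite + 'b::finite)"
  shows "v \<bullet> w = (\<Sum>i\<in>UNIV. v $ Inl i * w $ Inl i) + (\<Sum>j\<in>UNIV. v $ Inr j * w $ Inr j)"
  unfolding inner_vec_def UNIV_Plus_UNIV[symmetric] by (subst sum.Plus) simp_all

lemma ex_null_vector_orthogonal:
  fixes k :: "real ^ ('a::finite + 'b::finite)"
  assumes "CARD('a) \<ge> 2" "CARD('b) \<ge> 2" and k: "k \<in> integer_vectors"
  obtains v where "v \<in> null_vectors" "k \<bullet> v = 0"
proof -
  obtain i1 i2 :: 'a where i: "i1 \<noteq> i2"
    using assms(1) card_le_Suc0_iff_eq[of "UNIV :: 'a set"] by fastforce
  obtain j1 j2 :: 'b where j: "j1 \<noteq> j2"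
    using assms(2) card_le_Suc0_iff_eq[of "UNIV :: 'b set"] by fastforce
  \<comment> \<open>The inner product of \<open>k\<close> with the vector \<open>v\<close> built
    below is \<open>s * t0 - t * s0\<close>. So \<open>s = s0\<close>, \<open>t = t0\<close> makes
    it vanish; if both are 0, any non-zero integer pair works, such as \<open>s = 1\<close>,
    \<open>t = 0\<close>.\<close>
  define s0 t0 where "s0 = k $ Inl i2 - k $ Inr j2" and "t0 = k $ Inl i1 - k $ Inr j1"
  obtain s t where st: "s \<in> \<int>" "t \<in> \<int>" "s \<noteq> 0 \<or> t \<noteq> 0" "s * t0 = t * s0"
  proof (cases "s0 = 0 \<and> t0 = 0")
    case True
    then show ?thesis using that[of 1 0] by simp
  next
    case False
    moreover have "s0 \<in> \<int>" "t0 \<in> \<int>"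
      using k by (auto simp: s0_def t0_def integer_vectors_def)
    ultimately show ?thesis using that[of s0 t0] by (auto simp: mult.commute)
  qed
  \<comment> \<open>As \<open>s\<close> and \<open>t\<close> vary, these vectors form a totally null plane, which meets
    the hyperplane orthogonal to \<open>k\<close>.\<close>
  define v :: "real ^ ('a + 'b)" where
    "v = (\<chi> l. case l of Inl i \<Rightarrow> if i = i1 then s else if i = i2 then - t else 0
                | Inr j \<Rightarrow> if j = j1 then - s else if j = j2 then t else 0)"
  have v: "v $ Inl i1 = s" "v $ Inl i2 = - t" "v $ Inr j1 = - s" "v $ Inr j2 = t"
    "\<And>i. i \<noteq> i1 \<Longrightarrow> i \<noteq> i2 \<Longrightarrow> v $ Inl i = 0" "\<And>j. j \<noteq> j1 \<Longrightarrow> j \<noteq> j2 \<Longrightarrow> v $ Inr j = 0"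
    using i j by (auto simp: v_def)
  note sums = sum_UNIV_two[OF i] sum_UNIV_two[OF j]
  have "minkowski v v = 0"
    unfolding minkowski_def by (subst sums, simp add: v)+ (simp add: v)
  moreover have "v \<in> integer_vectors"
    using st by (auto simp: integer_vectors_def v_def split: sum.split)
  moreover have "v \<noteq> 0"
    using st(3) v by (metis neg_0_equal_iff_equal zero_index)
  moreover have "k \<bullet> v = 0"
  proof -
    have "k \<bullet> v = s * t0 - t * s0"
      unfolding inner_sum_type by (subst sums, simp add: v)+ (simp add: v s0_def t0_def algebra_simps)
    then show ?thesis using st by simp
  qed
  ultimately show thesis
    using that by (simp add: null_vectors_def)
qed

text \<open>Nullity equates the squared lengths \<open>L\<close> and \<open>R\<close> of the two
  blocks, so neither can vanish when \<open>v \<noteq> 0\<close>. A block with a single component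
  then has that component non-zero.\<close>

lemma null_vector_definite_component:
  fixes v :: "real ^ ('a::finite + 'b::finite)"
  assumes v: "v \<in> null_vectors"
  shows "CARD('a) = 1 \<Longrightarrow> v $ Inl i \<noteq> 0" and "CARD('b) = 1 \<Longrightarrow> v $ Inr j \<noteq> 0"
proof -
  define L R where "L = (\<Sum>i\<in>UNIV. v $ Inl i * v $ Inl i)" and "R = (\<Sum>j\<in>UNIV. v $ Inr j * v $ Inr j)"
  have "L = R" "v \<bullet> v = L + R" "v \<noteq> 0"
    using v by (auto simp: null_vectors_def minkowski_def L_def R_def inner_sum_type)
  then have pos: "L \<noteq> 0" "R \<noteq> 0"
    by (auto simp: inner_eq_zero_iff)
  show "v $ Inl i \<noteq> 0" if "CARD('a) = 1"
  proof -
    have UNIV: "UNIV = {i}"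
      using that card_1_singletonE by (metis UNIV_I singletonD)
    have "L = v $ Inl i * v $ Inl i"
      unfolding L_def UNIV by simp
    then show ?thesis using pos(1) by auto
  qed
  show "v $ Inr j \<noteq> 0" if "CARD('b) = 1"
  proof -
    have UNIV: "UNIV = {j}"
      using that card_1_singletonE by (metis UNIV_I singletonD)
    have "R = v $ Inr j * v $ Inr j"
      unfolding R_def UNIV by simp
    then show ?thesis using pos(2) by auto
  qed
qed

subsection \<open>The null X-ray transform\<close>

text \<open>The phase \<open>k \<bullet> (t *\<^sub>R v)\<close> is zero, so the integrand is
  constant on an interval of length 1.\<close>

lemma line_integral_character:
  assumes "\<And>x y. f (x + y) = cis (2 * pi * (k \<bullet> y)) * f x" "k \<bullet> v = 0"
  shows "line_integral v f = f"
  by (simp add: line_integral_def assms(1)[of _ "_ *\<^sub>R v"] assms(2))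

lemma null_xray_noninjective:
  fixes c :: "real ^ ('a::finite + 'b::finite) \<Rightarrow> real"
  assumes c: "conformal_factor c" and card: "\<not> (CARD('a) \<ge> 2 \<and> CARD('b) \<ge> 2)"
  shows "\<not> inj_on (null_xray c) (conformal_trig_polys c)"
proof -
  have "CARD('a) = 1 \<or> CARD('b) = 1"
    using card zero_less_card_finite[where 'a = 'a] zero_less_card_finite[where 'a = 'b] by linarith
  \<comment> \<open>\<open>l\<close> is the index of a one-dimensional factor, and the invisible
    frequency is \<open>axis l 1\<close>.\<close>
  then obtain l :: "'a + 'b" where l: "\<And>v. v \<in> null_vectors \<Longrightarrow> v $ l \<noteq> 0"
    using null_vector_definite_component by blast
  define e where "e = (\<lambda>x :: real ^ ('a + 'b). cis (2 * pi * x $ l))"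
  \<comment> \<open>Division by \<open>sqrt c\<close> cancels the conformal weight, leaving the
    character \<open>e\<close> to be integrated.\<close>
  define f where "f = (\<lambda>x. e x / of_real (sqrt (c x)))"
  have pos: "c x > 0" for x
    using c by (simp add: conformal_factor_def)
  have "c x \<noteq> 0" for x
    using pos[of x] by simp
  then have wf: "conformal_weight c f = e"
    by (auto simp: conformal_weight_def f_def fun_eq_iff)
  have w0: "conformal_weight c (\<lambda>_. 0) = (\<lambda>_. 0)"
    by (simp add: conformal_weight_def)
  have "e \<in> trig_polys"
    unfolding trig_polys_def mem_Collect_eq
    by (rule exI[of _ "{axis l 1}"], rule exI[of _ "\<lambda>_. 1"])
      (auto simp: e_def axis_integer_vectors inner_axis' cis_conv_exp mult_ac)
  moreover have "(\<lambda>_. 0) \<in> trig_polys"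
    unfolding trig_polys_def mem_Collect_eq
    by (rule exI[of _ "{}"]) simp
  ultimately have "f \<in> conformal_trig_polys c" "(\<lambda>_. 0) \<in> conformal_trig_polys c"
    by (simp_all add: conformal_trig_polys_def wf w0)
  moreover have "f 0 \<noteq> 0"
    using pos[of 0] by (simp add: f_def e_def)
  then have "f \<noteq> (\<lambda>_. 0)"
    by auto
  moreover have "null_xray c f = null_xray c (\<lambda>_. 0)"
    unfolding null_xray_def wf w0
  proof (rule restrict_ext)
    fix v :: "real ^ ('a + 'b)"
    assume v: "v \<in> null_vectors"
    then obtain m where m: "v $ l = of_int m"
      by (auto simp: null_vectors_def integer_vectors_def elim: Ints_cases)
    have "((\<lambda>t. cis (2 * pi * x $ l) * cis (2 * pi * (of_int m * t))) has_integral
        cis (2 * pi * x $ l) * (if m = 0 then 1 else 0)) {0..1}" for x :: "real ^ ('a + 'b)"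
      by (intro has_integral_mult_right integral_cis)
    moreover have "m \<noteq> 0"
      using l[OF v] m by simp
    moreover have "e (x + t *\<^sub>R v) = cis (2 * pi * x $ l) * cis (2 * pi * (of_int m * t))" for x t
      by (simp add: e_def m cis_mult algebra_simps)
    ultimately have "((\<lambda>t. e (x + t *\<^sub>R v)) has_integral 0) {0..1}" for x
      by simp
    then have "integral {0..1} (\<lambda>t. e (x + t *\<^sub>R v)) = 0" for x
      by (rule integral_unique)
    then show "line_integral v e = line_integral v (\<lambda>_. 0)"
      by (simp add: line_integral_def)
  qed
  ultimately show ?thesis
    unfolding inj_on_def by blast
qed

text \<open>\<open>fourier_mode_induct\<close> is applied to the class of continuous functions with
  vanishing null integrals. A character in this class equals its own integral along an orthogonal
  null vector, and hence vanishes.\<close>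

lemma continuous_zero_if_line_integrals_zero:
  fixes h :: "real ^ ('a::finite + 'b::finite) \<Rightarrow> complex"
  assumes card: "CARD('a) \<ge> 2" "CARD('b) \<ge> 2"
    and h: "h \<in> continuous_functions" "\<And>v. v \<in> null_vectors \<Longrightarrow> line_integral v h = (\<lambda>_. 0)"
  shows "h = (\<lambda>_. 0)"
proof (rule fourier_mode_induct[where Q = "\<lambda>h. h = (\<lambda>_. 0)" and D = "{h \<in> continuous_functions. \<forall>v\<in>null_vectors. line_integral v h = (\<lambda>_. 0)}"])
  show "h \<in> {h \<in> continuous_functions. \<forall>v\<in>null_vectors. line_integral v h = (\<lambda>_. 0)}"
    using h by blast
next
  fix f :: "real ^ ('a + 'b) \<Rightarrow> complex" and i m
  assume f: "f \<in> {h \<in> continuous_functions. \<forall>v\<in>null_vectors. line_integral v h = (\<lambda>_. 0)}"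
  have "line_integral v (fourier_mode i m f) = (\<lambda>_. 0)" if "v \<in> null_vectors" for v
  proof -
    \<comment> \<open>Both operators are line averages and commute, so each mode inherits the
      vanishing integrals.\<close>
    have "line_integral v (fourier_mode i m f) = fourier_mode i m (line_integral v f)"
      unfolding line_integral_eq fourier_mode_def using f
      by (intro line_average_commute continuous_on_cis_linear) (auto simp: continuous_functions_def)
    then show ?thesis
      using f that by (simp add: fourier_mode_def line_average_def)
  qed
  then show "fourier_mode i m f \<in> {h \<in> continuous_functions. \<forall>v\<in>null_vectors. line_integral v h = (\<lambda>_. 0)}"
    using f unfolding fourier_mode_def
    by (auto intro!: line_average_continuous_functions continuous_intros)
next
  fix f :: "real ^ ('a + 'b) \<Rightarrow> complex" and i
  assume f: "f \<in> {h \<in> continuous_functions. \<forall>v\<in>null_vectors. line_integral v h = (\<lambda>_. 0)}"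
    and modes: "\<And>m. fourier_mode i m f = (\<lambda>_. 0)"
  \<comment> \<open>Fejer means are finite combinations of the modes, all zero by hypothesis, yet
    they converge to \<open>f\<close>.\<close>
  have "fejer_mean i n f = (\<lambda>_. 0)" for n
    using f by (subst fejer_mean_eq_sum) (auto simp: modes)
  then have "(\<lambda>n. 0) \<longlonglongrightarrow> f x" for x
    using tendsto_uniform_limitI[OF fejer_mean_uniform_limit[of f i], of x] f by simp
  then show "f = (\<lambda>_. 0)"
    by (auto simp: fun_eq_iff LIMSEQ_const_iff)
next
  fix f :: "real ^ ('a + 'b) \<Rightarrow> complex" and k
  assume f: "f \<in> {h \<in> continuous_functions. \<forall>v\<in>null_vectors. line_integral v h = (\<lambda>_. 0)}"
    and k: "k \<in> integer_vectors" "\<And>x y. f (x + y) = cis (2 * pi * (k \<bullet> y)) * f x"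
  obtain v where "v \<in> null_vectors" "k \<bullet> v = 0"
    using ex_null_vector_orthogonal[OF card k(1)] by blast
  then show "f = (\<lambda>_. 0)"
    using line_integral_character[OF k(2)] f by auto
qed auto

lemma null_xray_injective:
  fixes c :: "real ^ ('a::finite + 'b::finite) \<Rightarrow> real"
  assumes c: "conformal_factor c" and card: "CARD('a) \<ge> 2" "CARD('b) \<ge> 2"
  shows "inj_on (null_xray c) continuous_functions"
proof (rule inj_onI)
  fix f g
  assume f: "f \<in> continuous_functions" and g: "g \<in> continuous_functions"
    and eq: "null_xray c f = null_xray c g"
  have c_props: "periodic c" "continuous_on UNIV c" "\<And>x. c x > 0"
    using c smooth_continuous_on by (auto simp: conformal_factor_def)
  have w: "conformal_weight c h \<in> continuous_functions" if "h \<in> continuous_functions" for h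
    using that c_props unfolding continuous_functions_def conformal_weight_def periodic_def
    by (auto intro!: continuous_intros)
  define h where "h = (\<lambda>x. conformal_weight c f x - conformal_weight c g x)"
  have "h = (\<lambda>_. 0)"
  proof (rule continuous_zero_if_line_integrals_zero[OF card])
    show "h \<in> continuous_functions"
      using w[OF f] w[OF g] unfolding continuous_functions_def h_def periodic_def
      by (auto intro!: continuous_intros)
    fix v :: "real ^ ('a + 'b)"
    assume v: "v \<in> null_vectors"
    have int: "(\<lambda>t. F (x + t *\<^sub>R v)) integrable_on {0..1}" if "F \<in> continuous_functions" for F x
      using integrable_line[of F "\<lambda>_. 1" x v] that by (simp add: continuous_functions_def)
    have "line_integral v (conformal_weight c f) = line_integral v (conformal_weight c g)"
      using fun_cong[OF eq, of v] v by (simp add: null_xray_def)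
    then show "line_integral v h = (\<lambda>_. 0)"
      unfolding line_integral_def h_def
      by (simp add: integral_diff int w f g fun_eq_iff)
  qed
  then show "f = g"
    using c_props(3) by (auto simp: h_def conformal_weight_def fun_eq_iff less_imp_neq[THEN not_sym])
qed

section \<open>Distributions on the torus\<close>

lemma test_functions_mult:
  assumes "g \<in> test_functions" "h \<in> test_functions"
  shows "(\<lambda>x. g x * h x) \<in> test_functions"
  using assms by (auto simp: test_functions_def periodic_def intro: smooth_mult)

lemma test_functions_add:
  assumes "g \<in> test_functions" "h \<in> test_functions"
  shows "(\<lambda>x. g x + h x) \<in> test_functions"
  using assms by (auto simp: test_functions_def periodic_def intro: smooth_add)

lemma test_functions_const: "(\<lambda>_. a) \<in> test_functions"
  by (simp add: test_functions_def periodic_def smooth_const)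

lemma
  assumes "T \<in> distributions"
  shows distribution_add: "\<phi> \<in> test_functions \<Longrightarrow> \<psi> \<in> test_functions \<Longrightarrow> T (\<lambda>x. \<phi> x + \<psi> x) = T \<phi> + T \<psi>"
    and distribution_scale: "\<phi> \<in> test_functions \<Longrightarrow> T (\<lambda>x. a * \<phi> x) = a * T \<phi>"
    and distribution_tendsto: "\<phi> \<in> test_functions \<Longrightarrow> (\<And>n. \<Phi> n \<in> test_functions) \<Longrightarrow>
      test_convergent \<Phi> \<phi> \<Longrightarrow> (\<lambda>n. T (\<Phi> n)) \<longlonglongrightarrow> T \<phi>"
  using assms by (simp_all add: distributions_def)

text \<open>Membership in \<open>test_functions\<close> is proved along with the formula because
  additivity of \<open>T\<close> needs it for the partial sum at each step.\<close>

lemma distribution_sum: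
  assumes T: "T \<in> distributions" and "finite P" "\<And>p. p \<in> P \<Longrightarrow> F p \<in> test_functions"
  shows "(\<lambda>x. \<Sum>p\<in>P. a * F p x) \<in> test_functions \<and> T (\<lambda>x. \<Sum>p\<in>P. a * F p x) = (\<Sum>p\<in>P. a * T (F p))"
  using assms(2,3)
proof (induction P)
  case empty
  have "T (\<lambda>_. 0) = 0"
    using distribution_scale[OF T test_functions_const, of 0 0] by simp
  then show ?case
    by (simp add: test_functions_const)
next
  case (insert p P)
  then have "(\<lambda>x. a * F p x) \<in> test_functions"
    by (intro test_functions_mult test_functions_const) auto
  moreover have "T (\<lambda>x. a * F p x) = a * T (F p)"
    using distribution_scale[OF T] insert.prems by simp
  moreover have "T (\<lambda>x. a * F p x + (\<Sum>p\<in>P. a * F p x)) = T (\<lambda>x. a * F p x) + T (\<lambda>x. \<Sum>p\<in>P. a * F p x)"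
    using insert calculation(1) by (intro distribution_add[OF T]) auto
  ultimately show ?case
    using insert by (auto intro: test_functions_add)
qed

text \<open>By duality the transform at \<open>v\<close> sends \<open>\<phi>\<close> to
  \<open>T\<close> applied to the weighted line integral of \<open>\<phi>\<close>. Choosing
  \<open>v\<close> orthogonal to the frequency of a character recovers \<open>T\<close> on the
  weighted character; Fejer means extend this to all weighted test functions, which exhaust the test
  functions.\<close>

lemma null_xray_distr_injective:
  fixes c :: "real ^ ('a::finite + 'b::finite) \<Rightarrow> real"
  assumes c: "conformal_factor c" and card: "CARD('a) \<ge> 2" "CARD('b) \<ge> 2"
  shows "inj_on (null_xray_distr c) distributions"
proof (rule inj_onI)
  fix T1 T2 :: "(real ^ ('a + 'b) \<Rightarrow> complex) \<Rightarrow> complex"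
  assume T1: "T1 \<in> distributions" and T2: "T2 \<in> distributions"
    and eq: "null_xray_distr c T1 = null_xray_distr c T2"
  have c_props: "periodic c" "smooth c" "\<And>x. c x > 0"
    using c by (auto simp: conformal_factor_def)
  have sqrt_test: "(\<lambda>x. of_real (sqrt (c x))) \<in> test_functions"
    and inv_test: "(\<lambda>x. of_real (inverse (sqrt (c x)))) \<in> test_functions"
    using c_props smooth_of_real[OF smooth_sqrt[OF c_props(2,3)]]
      smooth_of_real[OF smooth_inverse_sqrt[OF c_props(2,3)]]
    by (simp_all add: test_functions_def periodic_def)
  have w: "conformal_weight c \<phi> \<in> test_functions" if "\<phi> \<in> test_functions" for \<phi>
    unfolding conformal_weight_def by (intro test_functions_mult sqrt_test that)
  \<comment> \<open>The induction decomposes \<open>\<phi>\<close> before the weight is applied,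
    because multiplication by \<open>sqrt c\<close> does not preserve characters in general.\<close>
  have weighted: "T1 (conformal_weight c \<phi>) = T2 (conformal_weight c \<phi>)" if "\<phi> \<in> test_functions" for \<phi>
  proof (rule fourier_mode_induct[where f = \<phi> and D = test_functions])
    fix \<phi> :: "real ^ ('a + 'b) \<Rightarrow> complex" and i m
    assume "\<phi> \<in> test_functions"
    then show "fourier_mode i m \<phi> \<in> test_functions"
      unfolding fourier_mode_def by (intro line_average_test_functions continuous_on_cis_linear)
  next
    fix \<phi> :: "real ^ ('a + 'b) \<Rightarrow> complex" and i
    assume \<phi>: "\<phi> \<in> test_functions"
      and modes: "\<And>m. T1 (conformal_weight c (fourier_mode i m \<phi>)) = T2 (conformal_weight c (fourier_mode i m \<phi>))"
    have mode_test: "conformal_weight c (fourier_mode i m \<phi>) \<in> test_functions" for m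
      unfolding fourier_mode_def by (intro w line_average_test_functions continuous_on_cis_linear \<phi>)
    have mean_test: "fejer_mean i n \<phi> \<in> test_functions" for n
      unfolding fejer_mean_def
      by (intro line_average_test_functions \<phi> continuous_on_of_real continuous_on_fejer)
    have mean: "T (conformal_weight c (fejer_mean i n \<phi>)) = (\<Sum>p\<in>{..n} \<times> {..n}.
        1 / of_nat (Suc n) * T (conformal_weight c (fourier_mode i (int (fst p) - int (snd p)) \<phi>)))"
      if "T \<in> distributions" for T n
    proof -
      have *: "conformal_weight c (fejer_mean i n \<phi>) = (\<lambda>x. \<Sum>p\<in>{..n} \<times> {..n}.
          1 / of_nat (Suc n) * conformal_weight c (fourier_mode i (int (fst p) - int (snd p)) \<phi>) x)"
        using \<phi> test_functions_continuous
        by (subst fejer_mean_eq_sum) (auto simp: conformal_weight_def sum_distrib_left split_beta mult.left_commute)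
      show ?thesis
        unfolding * by (rule distribution_sum[THEN conjunct2]) (use that mode_test in auto)
    qed
    have "test_convergent (\<lambda>n. conformal_weight c (fejer_mean i n \<phi>)) (conformal_weight c \<phi>)"
      unfolding conformal_weight_def
      by (intro test_convergent_mult sqrt_test \<phi> mean_test fejer_mean_test_convergent)
    then have "(\<lambda>n. T (conformal_weight c (fejer_mean i n \<phi>))) \<longlonglongrightarrow> T (conformal_weight c \<phi>)"
      if "T \<in> distributions" for T
      by (rule distribution_tendsto[OF that w[OF \<phi>] w[OF mean_test]])
    from this[OF T1] this[OF T2]
    show "T1 (conformal_weight c \<phi>) = T2 (conformal_weight c \<phi>)"
      unfolding mean[OF T1] mean[OF T2] modes by (rule LIMSEQ_unique)
  next
    fix \<phi> :: "real ^ ('a + 'b) \<Rightarrow> complex" and k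
    assume \<phi>: "\<phi> \<in> test_functions" and k: "k \<in> integer_vectors"
      "\<And>x y. \<phi> (x + y) = cis (2 * pi * (k \<bullet> y)) * \<phi> x"
    obtain v where v: "v \<in> null_vectors" "k \<bullet> v = 0"
      using ex_null_vector_orthogonal[OF card k(1)] by blast
    have "null_xray_distr c T v \<phi> = T (conformal_weight c \<phi>)" for T
      using v \<phi> line_integral_character[OF k(2) v(2)]
      by (simp add: null_xray_distr_def line_integral_distr_def conformal_weight_distr_def)
    then show "T1 (conformal_weight c \<phi>) = T2 (conformal_weight c \<phi>)"
      using eq by metis
  qed (use that test_functions_continuous in auto)
  show "T1 = T2"
  proof (rule extensionalityI[of _ test_functions])
    fix \<psi> :: "real ^ ('a + 'b) \<Rightarrow> complex"
    assume \<psi>: "\<psi> \<in> test_functions"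
    \<comment> \<open>The weight maps onto the test functions since \<open>1 / sqrt c\<close> is
      smooth and periodic.\<close>
    have "conformal_weight c (\<lambda>x. of_real (inverse (sqrt (c x))) * \<psi> x) = \<psi>"
      using c_props(3) by (auto simp: conformal_weight_def fun_eq_iff less_imp_neq[THEN not_sym])
    then show "T1 \<psi> = T2 \<psi>"
      using weighted[OF test_functions_mult[OF inv_test \<psi>]] by simp
  qed (use T1 T2 in \<open>auto simp: distributions_def\<close>)
qed

text \<open>Injectivity passes to subspaces, so the two extreme cases suffice for every intermediate
  \<open>X\<close>: injectivity is proved on all continuous functions, and its failure already on
  \<open>conformal_trig_polys c\<close>.\<close>

theorem theorem8:
  fixes c :: "real ^ ('a::finite + 'b::finite) \<Rightarrow> real"
    and X :: "(real ^ ('a + 'b) \<Rightarrow> complex) set"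
  assumes "conformal_factor c"
    and "conformal_trig_polys c \<subseteq> X" and "X \<subseteq> continuous_functions"
  shows "(inj_on (null_xray c) X \<longleftrightarrow> CARD('a) \<ge> 2 \<and> CARD('b) \<ge> 2) \<and>
    (inj_on (null_xray c) X \<longrightarrow> inj_on (null_xray_distr c) distributions) \<and>
    (\<not> inj_on (null_xray c) X \<longrightarrow> \<not> inj_on (null_xray c) (conformal_trig_polys c))"
proof (cases "CARD('a) \<ge> 2 \<and> CARD('b) \<ge> 2")
  case True
  then have "inj_on (null_xray c) X"
    using null_xray_injective[OF assms(1)] inj_on_subset[OF _ assms(3)] by blast
  then show ?thesis
    using True null_xray_distr_injective[OF assms(1)] by blast
next
  case False
  then have "\<not> inj_on (null_xray c) (conformal_trig_polys c)"
    by (rule null_xray_noninjective[OF assms(1)])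
  then show ?thesis
    using False inj_on_subset[OF _ assms(2)] by blast
qed

end
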